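(* Let $c$ be a constant with $0<c<\frac12$. There exists a real constant $\delta=\delta(c)>0$ such that for every $n\in\mathbb{N}$ and every integer $k$ with $cn<k<(1-c)n$, $$\max\{\beta_{[\pm1]}(n,k),\beta_{[\pm1]}(n,k-1),\beta_{[\pm1]}(n,k-2),\beta_{[\pm1]}(n,k-3)\}\ge \delta n.$$
   Context: For a positive integer $n$, $[n]=\{1,\dots,n\}$ and $\binom{[n]}{k}$ is the family of all $k$-element subsets of $[n]$. For a set $D$ of integers and families $\mathcal{F},\mathcal{F}'$ of subsets of $[n]$, $\mathcal{F}'$ is called $D$-secting for $\mathcal{F}$ if for every $A\in\mathcal{F}$ there exists $A'\in\mathcal{F}'$ with $|A\cap A'|-|A\cap([n]\setminus A')|\in D$. $\beta_D(\mathcal{F})$ is the minimum cardinality of a $D$-secting family for $\mathcal{F}$; $\beta_{[\pm 1]}$ denotes $\beta_D$ with $D=\{-1,0,1\}$. $\beta_{[\pm1]}(n,k)$ is the maximum of $\beta_{[\pm1]}(\mathcal{F})$ over all families $\mathcal{F}\subseteq\binom{[n]}{k}$. *)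

theory Defs
  imports Complex_Main
begin

definition D_secting :: "nat \<Rightarrow> int set \<Rightarrow> nat set set \<Rightarrow> nat set set \<Rightarrow> bool" where
  "D_secting n D F F' \<longleftrightarrow>
     (\<forall>A\<in>F. \<exists>A'\<in>F'. int (card (A \<inter> A')) - int (card (A \<inter> ({1..n} - A'))) \<in> D)"

definition beta :: "nat \<Rightarrow> int set \<Rightarrow> nat set set \<Rightarrow> nat" where
  "beta n D F = Min {card F' | F'. F' \<subseteq> Pow {1..n} \<and> D_secting n D F F'}"

text \<open>The size \<open>k\<close> is an integer so that \<open>k - 1\<close>, \<open>k - 2\<close>, \<open>k - 3\<close> are not truncated
  at zero; for negative \<open>k\<close> there are no \<open>k\<close>-element subsets.\<close>

definition k_subsets :: "nat \<Rightarrow> int \<Rightarrow> nat set set" where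
  "k_subsets n k = {A. A \<subseteq> {1..n} \<and> int (card A) = k}"

definition beta_pm1 :: "nat \<Rightarrow> int \<Rightarrow> nat" where
  "beta_pm1 n k = Max {beta n {-1, 0, 1} F | F. F \<subseteq> k_subsets n k}"

text \<open>The sets under \<^const>\<open>Min\<close> and \<^const>\<open>Max\<close> are finite and, for \<open>D = {-1, 0, 1}\<close>, nonempty,
  so the minimum and the maximum are attained.\<close>

lemma finite_beta_set: "finite {card F' | F'. F' \<subseteq> Pow {1..n} \<and> D_secting n D F F'}"
proof -
  have "{card F' | F'. F' \<subseteq> Pow {1..n} \<and> D_secting n D F F'} \<subseteq> card ` Pow (Pow {1..n})"
    by auto
  then show ?thesis
    by (rule finite_subset) simp
qed

lemma D_secting_Pow:
  assumes "F \<subseteq> Pow {1..n}"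
  shows "D_secting n {-1, 0, 1} F (Pow {1..n})"
  unfolding D_secting_def
proof
  fix A assume "A \<in> F"
  with assms have A: "A \<subseteq> {1..n}" by auto
  then have fin: "finite A" by (rule finite_subset) simp
  obtain B where B: "B \<subseteq> A" "card B = card A div 2"
    by (meson obtain_subset_with_card_n div_le_dividend)
  have "A \<inter> B = B" "A \<inter> ({1..n} - B) = A - B" using A B by auto
  moreover have "card (A - B) = card A - card A div 2"
    using B fin by (simp add: card_Diff_subset finite_subset)
  ultimately have "int (card (A \<inter> B)) - int (card (A \<inter> ({1..n} - B))) \<in> {-1, 0, 1}"
    using B(2) by simp presburger
  then show "\<exists>A'\<in>Pow {1..n}. int (card (A \<inter> A')) - int (card (A \<inter> ({1..n} - A'))) \<in> {-1, 0, 1}"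
    using A B by blast
qed

lemma beta_attained:
  assumes "F \<subseteq> Pow {1..n}"
  shows "\<exists>F'. F' \<subseteq> Pow {1..n} \<and> D_secting n {-1, 0, 1} F F' \<and> card F' = beta n {-1, 0, 1} F"
proof -
  have "{card F' | F'. F' \<subseteq> Pow {1..n} \<and> D_secting n {-1, 0, 1} F F'} \<noteq> {}"
    using D_secting_Pow[OF assms] by blast
  from Min_in[OF finite_beta_set this]
  have "beta n {-1, 0, 1} F \<in> {card F' | F'. F' \<subseteq> Pow {1..n} \<and> D_secting n {-1, 0, 1} F F'}"
    unfolding beta_def .
  then show ?thesis
    unfolding mem_Collect_eq by metis
qed

lemma beta_pm1_attained:
  "\<exists>F. F \<subseteq> k_subsets n k \<and> beta n {-1, 0, 1} F = beta_pm1 n k"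
proof -
  let ?S = "{beta n {-1, 0, 1} F | F. F \<subseteq> k_subsets n k}"
  have "?S = beta n {-1, 0, 1} ` Pow (k_subsets n k)" by auto
  moreover have "finite (k_subsets n k)"
    by (rule finite_subset[of _ "Pow {1..n}"]) (auto simp: k_subsets_def)
  ultimately have "finite ?S" by simp
  moreover have "?S \<noteq> {}" by auto
  ultimately have "beta_pm1 n k \<in> ?S"
    unfolding beta_pm1_def by (rule Max_in)
  then show ?thesis
    unfolding mem_Collect_eq by metis
qed

end

theory Submission imports Defs "HOL-Library.FuncSet"
begin

text \<open>One of the four sizes is some \<open>K\<close> with \<open>K mod 4 = 2\<close>. A set that splits a \<open>K\<close>-set \<open>A\<close> with discrepancy
  at most 1 meets \<open>A\<close> in \<open>K / 2\<close> points, an odd number. Given \<open>m\<close> sets that split all \<open>K\<close>-sets, classify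
  the \<open>h\<close>-subsets of a \<open>2h\<close>-set by the parities of their intersections with these \<open>m\<close> sets. If \<open>x\<close> and \<open>y\<close>
  lie in the same class, their symmetric difference meets each of the \<open>m\<close> sets evenly, so it does not have
  \<open>K\<close> elements, that is, the intersection of \<open>x\<close> and \<open>y\<close> does not have \<open>l = h - K / 2\<close> elements. The
  largest of the \<open>2^m\<close> classes would, for small \<open>m\<close>, contradict the theorem of Frankl and Roedl that
  families with a forbidden cross intersection size are exponentially small.

  That theorem is proved here for \<open>l \<le> N / 4\<close> by a density increment. Split \<open>F\<close> and \<open>G\<close> at a point into
  the parts \<open>F0\<close>, \<open>G0\<close> avoiding it and the links \<open>F1\<close>, \<open>G1\<close>, and let \<open>F\<close>, \<open>G\<close> avoid intersection sizes in
  \<open>[a, b]\<close>. Then \<open>F0 \<union> F1\<close>, \<open>G0\<close> still avoid \<open>[a, b]\<close>, while \<open>F1\<close>, \<open>G1\<close> avoid \<open>[a - 1, b - 1]\<close>, and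
  \<open>F0 \<inter> F1\<close>, \<open>G1\<close> avoid the longer interval \<open>[a - 1, b]\<close>. If neither of the first two pairs (nor their
  mirror images) is noticeably denser, the third pair is hardly sparser. The interval therefore grows
  until it contains every possible intersection size.\<close>

section \<open>The density increment\<close>

text \<open>The density bound may grow by the factors \<open>k\<close>, \<open>s\<close>, \<open>g\<close> when a deletion keeps the forbidden
  interval, shifts it down or grows it. If the five pairs of parts all stayed below these factors, the
  relative imbalances between \<open>F0 \<union> F1\<close> and \<open>F0 \<inter> F1\<close> and between \<open>G1\<close> and \<open>G0\<close> would have a product
  larger than \<open>(2 - k - g) / 2\<close>, yet at most \<open>(s - 1) (k + s - 2) / (2 - s)\<close>.\<close>

definition admissible_factors :: "real \<Rightarrow> real \<Rightarrow> real \<Rightarrow> bool" where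
  "admissible_factors k s g \<longleftrightarrow>
     s < 2 \<and> k + g \<le> 2 \<and> 2 * ((s - 1) * (k + s - 2)) \<le> (2 - k - g) * (2 - s)"

lemma some_density_large:
  fixes p q p' q' :: real
  assumes adm: "admissible_factors k s g" and p: "0 \<le> p" "0 \<le> p'"
  shows "k \<le> (1 + p) * (1 - q) \<or> k \<le> (1 - q') * (1 + p') \<or> s \<le> (1 + q') * (1 + q) \<or>
    g \<le> (1 - p) * (1 + q) \<or> g \<le> (1 + q') * (1 - p')"
proof (rule ccontr)
  assume "\<not> ?thesis"
  then have keep: "(1 + p) * (1 - q) < k" "(1 + p') * (1 - q') < k"
    and shift: "(1 + q) * (1 + q') < s"
    and grow: "(1 - p) * (1 + q) < g" "(1 - p') * (1 + q') < g"
    by (simp_all add: mult.commute)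
  have factors: "s < 2" "k + g \<le> 2" "2 * ((s - 1) * (k + s - 2)) \<le> (2 - k - g) * (2 - s)"
    using adm by (simp_all add: admissible_factors_def)
  \<comment> \<open>The two products add up to \<open>2 - 2 x y\<close>, so only this second-order term can make both small.\<close>
  have product_large: "2 - k - g < 2 * (x * y)"
    if "(1 + x) * (1 - y) < k" "(1 - x) * (1 + y) < g" for x y :: real
    using that by (simp add: algebra_simps)
  have products: "2 - k - g < 2 * (p * q)" "2 - k - g < 2 * (p' * q')"
    using product_large keep grow by auto
  then have "0 < p * q" "0 < p' * q'" using factors(2) by auto
  then have pos: "0 < p" "0 < q" "0 < q'" using p by (auto simp: zero_less_mult_iff)
  then have "1 + q < (1 + q) * (1 + q')" by simp
  then have q: "q < s - 1" using shift by simp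
  have "p * (2 - s) \<le> p * (1 - q)" using p q by (intro mult_left_mono) auto
  also have "\<dots> < k + s - 2" using keep(1) q by (simp add: algebra_simps)
  finally have "p * (2 - s) < k + s - 2" .
  moreover have "0 < p * (2 - s)" using pos factors by simp
  ultimately have "q * (p * (2 - s)) \<le> (s - 1) * (k + s - 2)"
    using pos q by (intro mult_mono) auto
  then have "2 * (p * q) * (2 - s) \<le> 2 * ((s - 1) * (k + s - 2))"
    unfolding mult.assoc mult.left_commute[of q p] by (rule mult_left_mono) simp
  also have "\<dots> \<le> (2 - k - g) * (2 - s)" by (rule factors(3))
  finally have "2 * (p * q) \<le> 2 - k - g" using factors(1) by simp
  then show False using products(1) by simp
qed

lemma normalised_product_less:
  fixes u v f g X c :: real
  assumes "u * v \<le> X * c" "0 < c" "0 < f" "0 < g" "4 * X < f * g"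
  shows "(2 * u / f) * (2 * v / g) < c"
proof -
  have "4 * (u * v) \<le> (4 * X) * c" using assms(1) by simp
  also have "\<dots> < (f * g) * c" using assms(2,5) by (intro mult_strict_right_mono)
  finally show ?thesis using assms(3,4) by (simp add: field_simps)
qed

lemma density_increment:
  fixes X :: real
  assumes adm: "admissible_factors k s g" and factors_pos: "0 < k" "0 < s" "0 < g" and X: "0 \<le> X"
    and fin: "finite F0" "finite F1" "finite G0" "finite G1"
    and keep: "card (F0 \<union> F1) * card G0 \<le> X * k" "card F0 * card (G0 \<union> G1) \<le> X * k"
    and shift: "card F1 * card G1 \<le> X * s"
    and grow: "card (F0 \<inter> F1) * card G1 \<le> X * g" "card F1 * card (G0 \<inter> G1) \<le> X * g"
  shows "(card F0 + card F1) * (card G0 + card G1) \<le> 4 * X"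
proof (rule ccontr)
  define f where "f = real (card F0 + card F1)"
  define f' where "f' = real (card G0 + card G1)"
  assume "\<not> ?thesis"
  then have less: "4 * X < f * f'" by (simp add: f_def f'_def)
  then have "f \<noteq> 0" "f' \<noteq> 0" using X by auto
  then have pos: "0 < f" "0 < f'" by (simp_all add: f_def f'_def)
  have normalise: "(2 * real u / f) * (2 * real v / f') < c" if "real (u * v) \<le> X * c" "0 < c" for u v c
    using that normalised_product_less[OF _ _ pos less] by simp
  define p where "p = (real (card (F0 \<union> F1)) - real (card (F0 \<inter> F1))) / f"
  define p' where "p' = (real (card (G0 \<union> G1)) - real (card (G0 \<inter> G1))) / f'"
  define q where "q = (real (card G1) - real (card G0)) / f'"
  define q' where "q' = (real (card F1) - real (card F0)) / f"
  have "card (F0 \<inter> F1) \<le> card (F0 \<union> F1)" "card (G0 \<inter> G1) \<le> card (G0 \<union> G1)"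
    using fin by (auto intro!: card_mono)
  then have nonneg: "0 \<le> p" "0 \<le> p'" using pos by (simp_all add: p_def p'_def)
  have sums: "f = real (card (F0 \<union> F1)) + real (card (F0 \<inter> F1))"
    "f' = real (card (G0 \<union> G1)) + real (card (G0 \<inter> G1))"
    "f = real (card F1) + real (card F0)" "f' = real (card G1) + real (card G0)"
    using card_Un_Int[OF fin(1,2)] card_Un_Int[OF fin(3,4)] by (simp_all add: f_def f'_def)
  have imbalance: "1 + (u - v) / d = 2 * u / d" "1 - (u - v) / d = 2 * v / d"
    if "d = u + v" "0 < d" for u v d :: real
    using that by (simp_all add: field_simps)
  note densities = imbalance[OF sums(1) pos(1), folded p_def] imbalance[OF sums(2) pos(2), folded p'_def]
    imbalance[OF sums(3) pos(1), folded q'_def] imbalance[OF sums(4) pos(2), folded q_def]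
  have "(1 + p) * (1 - q) < k" "(1 - q') * (1 + p') < k" "(1 + q') * (1 + q) < s"
    "(1 - p) * (1 + q) < g" "(1 + q') * (1 - p') < g"
    unfolding densities by (intro normalise keep shift grow factors_pos)+
  then show False using some_density_large[OF adm nonneg, of q q'] by linarith
qed

lemma exp_minus_le_quadratic:
  fixes x :: real
  assumes "0 \<le> x"
  shows "exp (- x) \<le> 1 - x + x\<^sup>2"
proof -
  have "1 \<le> 1 + x ^ 3" using assms by simp
  also have "\<dots> = (1 + x) * (1 - x + x\<^sup>2)"
    by (simp add: algebra_simps power2_eq_square power3_eq_cube)
  also have "\<dots> \<le> exp x * (1 - x + x\<^sup>2)"
  proof (rule mult_right_mono)
    have "x \<le> 1 + x\<^sup>2" using sum_squares_bound[of x 1] assms by simp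
    then show "0 \<le> 1 - x + x\<^sup>2" by simp
  qed (rule exp_ge_add_one_self)
  finally show ?thesis by (simp add: exp_minus field_simps)
qed

lemma admissible_factors_exp:
  fixes \<epsilon> \<sigma> :: real
  assumes "4 * \<sigma>\<^sup>2 \<le> \<epsilon>" "\<epsilon> \<le> \<sigma> / 20"
  shows "admissible_factors (exp (2 * \<epsilon>)) (exp \<sigma>) (exp (- (3 * \<epsilon>)))"
proof -
  have "0 \<le> \<epsilon>" using assms(1) zero_le_power2[of \<sigma>] by linarith
  moreover have "\<sigma> \<le> 1 / 80"
  proof (rule ccontr)
    assume "\<not> ?thesis"
    then have "\<sigma> * (1 / 80) < \<sigma> * \<sigma>" by (intro mult_strict_left_mono) auto
    then show False using assms by (simp add: power2_eq_square)
  qed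
  ultimately have bounds: "0 \<le> \<epsilon>" "\<epsilon> \<le> 1 / 1600" "0 \<le> \<sigma>" "\<sigma> \<le> 1 / 80" using assms(2) by auto
  have squares: "\<epsilon>\<^sup>2 \<le> \<epsilon> / 1600" "\<sigma>\<^sup>2 \<le> \<sigma> / 80"
    using mult_left_mono[OF bounds(2,1)] mult_left_mono[OF bounds(4,3)]
    by (simp_all add: power2_eq_square)
  have keep: "exp (2 * \<epsilon>) \<le> 1 + 2 * \<epsilon> + 4 * \<epsilon>\<^sup>2" using exp_bound[of "2 * \<epsilon>"] bounds by simp
  have grow: "exp (- (3 * \<epsilon>)) \<le> 1 - 3 * \<epsilon> + 9 * \<epsilon>\<^sup>2"
    using exp_minus_le_quadratic[of "3 * \<epsilon>"] bounds by simp
  have shift: "exp \<sigma> \<le> 1 + \<sigma> + \<sigma> / 80" using exp_bound[of \<sigma>] bounds squares by simp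
  have loss: "9 / 10 * \<epsilon> \<le> 2 - exp (2 * \<epsilon>) - exp (- (3 * \<epsilon>))"
    using keep grow squares bounds by linarith
  have "2 * ((exp \<sigma> - 1) * (exp (2 * \<epsilon>) + exp \<sigma> - 2)) \<le> 2 * ((81 / 80 * \<sigma>) * (6 / 5 * \<sigma>))"
  proof (intro mult_left_mono mult_mono)
    show "exp (2 * \<epsilon>) + exp \<sigma> - 2 \<le> 6 / 5 * \<sigma>"
      using keep shift squares bounds assms(2) by linarith
    show "0 \<le> exp (2 * \<epsilon>) + exp \<sigma> - 2"
      using bounds one_le_exp_iff[of \<sigma>] one_le_exp_iff[of "2 * \<epsilon>"] by linarith
  qed (use shift bounds in auto)
  also have "\<dots> = 243 / 100 * \<sigma>\<^sup>2" by (simp add: power2_eq_square)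
  also have "\<dots> \<le> (9 / 10 * \<epsilon>) * (9 / 10)" using assms(1) bounds zero_le_power2[of \<sigma>] by linarith
  also have "\<dots> \<le> (2 - exp (2 * \<epsilon>) - exp (- (3 * \<epsilon>))) * (2 - exp \<sigma>)"
    using loss shift bounds by (intro mult_mono) auto
  finally show ?thesis
    unfolding admissible_factors_def using shift loss bounds by simp
qed

section \<open>Forbidden cross intersections\<close>

definition deletion :: "'a \<Rightarrow> 'a set set \<Rightarrow> 'a set set" where
  "deletion p F = {x \<in> F. p \<notin> x}"

definition link :: "'a \<Rightarrow> 'a set set \<Rightarrow> 'a set set" where
  "link p F = {x. p \<notin> x \<and> insert p x \<in> F}"

lemma card_deletion_link:
  assumes "finite F"
  shows "card (deletion p F) + card (link p F) = card F"
proof -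
  have "bij_betw (insert p) (link p F) (F - deletion p F)"
    by (rule bij_betw_byWitness[where f' = "\<lambda>x. x - {p}"])
      (auto simp: link_def deletion_def insert_absorb)
  then have "card (link p F) = card (F - deletion p F)" by (rule bij_betw_same_card)
  moreover have "deletion p F \<subseteq> F" by (auto simp: deletion_def)
  ultimately show ?thesis
    using assms by (simp add: card_Diff_subset card_mono finite_subset)
qed

definition cross_avoiding :: "'a set set \<Rightarrow> 'a set set \<Rightarrow> int set \<Rightarrow> bool" where
  "cross_avoiding F G L \<longleftrightarrow> (\<forall>x\<in>F. \<forall>y\<in>G. int (card (x \<inter> y)) \<notin> L)"

lemma cross_avoiding_sym: "cross_avoiding F G L \<Longrightarrow> cross_avoiding G F L"
  unfolding cross_avoiding_def by (metis Int_commute)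

lemma cross_avoiding_keep:
  assumes "cross_avoiding F G L"
  shows "cross_avoiding (deletion p F \<union> link p F) (deletion p G) L"
proof -
  have "insert p x \<inter> y = x \<inter> y" if "y \<in> deletion p G" for x y
    using that by (auto simp: deletion_def)
  then show ?thesis
    using assms unfolding cross_avoiding_def deletion_def link_def by fastforce
qed

lemma cross_avoiding_shift:
  assumes "cross_avoiding F G L" and "\<And>x. x \<in> F \<Longrightarrow> finite x"
  shows "cross_avoiding (link p F) (link p G) ((\<lambda>t. t - 1) ` L)"
  unfolding cross_avoiding_def
proof (intro ballI)
  fix x y assume xy: "x \<in> link p F" "y \<in> link p G"
  then have "finite (x \<inter> y)" using assms(2)[of "insert p x"] by (simp add: link_def)
  moreover have "insert p x \<inter> insert p y = insert p (x \<inter> y)" "p \<notin> x \<inter> y"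
    using xy by (auto simp: link_def)
  ultimately have "card (insert p x \<inter> insert p y) = Suc (card (x \<inter> y))" by simp
  moreover have "int (card (insert p x \<inter> insert p y)) \<notin> L"
    using assms(1) xy unfolding cross_avoiding_def link_def by blast
  ultimately show "int (card (x \<inter> y)) \<notin> (\<lambda>t. t - 1) ` L" by auto
qed

lemma cross_avoiding_grow:
  assumes "cross_avoiding F G L" and "\<And>x. x \<in> F \<Longrightarrow> finite x"
  shows "cross_avoiding (deletion p F \<inter> link p F) (link p G) (L \<union> (\<lambda>t. t - 1) ` L)"
  unfolding cross_avoiding_def
proof (intro ballI)
  fix x y assume xy: "x \<in> deletion p F \<inter> link p F" "y \<in> link p G"
  then have "x \<inter> insert p y = x \<inter> y" by (auto simp: deletion_def)
  moreover have "int (card (x \<inter> insert p y)) \<notin> L"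
    using assms(1) xy unfolding cross_avoiding_def deletion_def link_def by blast
  moreover have "int (card (x \<inter> y)) \<notin> (\<lambda>t. t - 1) ` L"
    using cross_avoiding_shift[OF assms] xy by (auto simp: cross_avoiding_def)
  ultimately show "int (card (x \<inter> y)) \<notin> L \<union> (\<lambda>t. t - 1) ` L" by simp
qed

lemma cross_avoiding_point_step:
  fixes X :: real
  assumes factors: "admissible_factors k s g" "0 < k" "0 < s" "0 < g" and X: "0 \<le> X"
    and S: "finite S" "F \<subseteq> Pow (insert p S)" "G \<subseteq> Pow (insert p S)"
    and avoid: "cross_avoiding F G {a..b}" and ab: "a \<le> b"
    and keep: "\<And>A B. A \<subseteq> Pow S \<Longrightarrow> B \<subseteq> Pow S \<Longrightarrow> cross_avoiding A B {a..b} \<Longrightarrow>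
      card A * card B \<le> X * k"
    and shift: "\<And>A B. A \<subseteq> Pow S \<Longrightarrow> B \<subseteq> Pow S \<Longrightarrow> cross_avoiding A B {a - 1..b - 1} \<Longrightarrow>
      card A * card B \<le> X * s"
    and grow: "\<And>A B. A \<subseteq> Pow S \<Longrightarrow> B \<subseteq> Pow S \<Longrightarrow> cross_avoiding A B {a - 1..b} \<Longrightarrow>
      card A * card B \<le> X * g"
  shows "card F * card G \<le> 4 * X"
proof -
  have fin: "finite F" "finite G" "\<And>x. x \<in> F \<Longrightarrow> finite x" "\<And>x. x \<in> G \<Longrightarrow> finite x"
    using S by (auto intro: finite_subset)
  have parts: "deletion p F \<subseteq> Pow S" "link p F \<subseteq> Pow S" "deletion p G \<subseteq> Pow S" "link p G \<subseteq> Pow S"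
    using S by (auto simp: deletion_def link_def)
  then have fin_parts: "finite (deletion p F)" "finite (link p F)"
    "finite (deletion p G)" "finite (link p G)"
    using S(1) by (auto intro: finite_subset)
  have shifted: "(\<lambda>t. t - 1) ` {a..b} = {a - 1..b - 1}" by simp
  have grown: "{a..b} \<union> (\<lambda>t. t - 1) ` {a..b} = {a - 1..b}" using ab by auto
  note avoid' = cross_avoiding_sym[OF avoid]
  have "(card (deletion p F) + card (link p F)) * (card (deletion p G) + card (link p G)) \<le> 4 * X"
  proof (rule density_increment[OF factors X fin_parts])
    show "card (deletion p F \<union> link p F) * card (deletion p G) \<le> X * k"
      using cross_avoiding_keep[OF avoid] parts by (intro keep) auto
    show "card (deletion p F) * card (deletion p G \<union> link p G) \<le> X * k"
      using cross_avoiding_keep[OF avoid', THEN cross_avoiding_sym] parts by (intro keep) auto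
    show "card (link p F) * card (link p G) \<le> X * s"
      using cross_avoiding_shift[OF avoid fin(3)] parts unfolding shifted by (intro shift)
    show "card (deletion p F \<inter> link p F) * card (link p G) \<le> X * g"
      using cross_avoiding_grow[OF avoid fin(3)] parts unfolding grown by (intro grow) auto
    show "card (link p F) * card (deletion p G \<inter> link p G) \<le> X * g"
      using cross_avoiding_grow[OF avoid' fin(4), THEN cross_avoiding_sym] parts
      unfolding grown by (intro grow) auto
  qed
  then show ?thesis
    unfolding card_deletion_link[OF fin(1)] card_deletion_link[OF fin(2)] .
qed

text \<open>The potential is the negative logarithm of the density bound that an induction deleting the
  points of the ground set one at a time can maintain for families avoiding intersection sizes in
  \<open>[a, b]\<close>. A deletion either keeps \<open>[a, b]\<close> and gains a factor \<open>exp \<kappa>\<close> in density, or shifts it down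
  by one and gains \<open>exp \<sigma>\<close>, or grows it to \<open>[a - 1, b]\<close> and loses at most \<open>exp \<gamma>\<close>. Starting from
  \<open>a = b = l\<close>, there have been \<open>l - b\<close> shifts and \<open>b - a\<close> growths.\<close>

definition potential :: "real \<Rightarrow> real \<Rightarrow> real \<Rightarrow> nat \<Rightarrow> nat \<Rightarrow> int \<Rightarrow> int \<Rightarrow> real" where
  "potential \<kappa> \<sigma> \<gamma> l n a b = \<kappa> * (real n - l - a) - \<sigma> * (l - b) - \<gamma> * (l + a - b)"

lemma potential_Suc:
  "potential \<kappa> \<sigma> \<gamma> l (Suc n) a b = potential \<kappa> \<sigma> \<gamma> l n a b + \<kappa>"
  "potential \<kappa> \<sigma> \<gamma> l (Suc n) a b = potential \<kappa> \<sigma> \<gamma> l n (a - 1) (b - 1) + \<sigma>"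
  "potential \<kappa> \<sigma> \<gamma> l (Suc n) a b = potential \<kappa> \<sigma> \<gamma> l n (a - 1) b - \<gamma>"
  by (simp_all add: potential_def algebra_simps)

lemma potential_0_nonpos:
  fixes \<kappa> \<sigma> \<gamma> :: real
  assumes rates: "0 \<le> \<kappa>" "0 \<le> \<sigma>" "0 \<le> \<gamma>" "(\<kappa> + \<gamma>) * N \<le> \<sigma> * l"
    and ab: "b \<le> int l" "- int N \<le> a" "0 \<notin> {a..b}"
  shows "potential \<kappa> \<sigma> \<gamma> l 0 a b \<le> 0"
proof (cases "0 < a")
  case True
  then have "0 \<le> \<kappa> * (l + a)" "0 \<le> \<sigma> * (l - b)" "0 \<le> \<gamma> * (l + a - b)"
    using rates ab by simp_all
  then show ?thesis by (simp add: potential_def algebra_simps)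
next
  case False
  then have "b < 0" using ab(3) by auto
  then have "real_of_int b \<le> 0" "- real N \<le> a" using ab(2) by linarith+
  then have "\<kappa> * (- real l - a) \<le> \<kappa> * N" "\<sigma> * l \<le> \<sigma> * (l - b)" "\<gamma> * (b - l - a) \<le> \<gamma> * N"
    using rates ab(1) by (auto intro!: mult_left_mono)
  then show ?thesis using rates(4) by (simp add: potential_def algebra_simps)
qed

lemma cross_avoiding_empty_ground_set:
  fixes t :: real
  assumes "F \<subseteq> {{}}" "G \<subseteq> {{}}" "cross_avoiding F G L" and t: "0 \<notin> L \<Longrightarrow> 0 \<le> t"
  shows "card F * card G \<le> exp t"
proof (cases "0 \<in> L")
  case True
  then have "F = {} \<or> G = {}"
    using assms(1-3) by (auto simp: cross_avoiding_def subset_singleton_iff)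
  then show ?thesis by auto
next
  case False
  have "card F \<le> 1" "card G \<le> 1"
    using card_mono[OF _ assms(1)] card_mono[OF _ assms(2)] by simp_all
  then have "card F * card G \<le> 1 * 1" by (rule mult_le_mono)
  then have "real (card F * card G) \<le> 1" by linarith
  also have "\<dots> \<le> exp t" using t[OF False] by simp
  finally show ?thesis .
qed

lemma cross_avoiding_potential_bound:
  fixes \<kappa> \<sigma> \<gamma> :: real and l N :: nat
  assumes adm: "admissible_factors (exp \<kappa>) (exp \<sigma>) (exp (- \<gamma>))"
    and rates: "0 \<le> \<kappa>" "0 \<le> \<sigma>" "0 \<le> \<gamma>" "(\<kappa> + \<gamma>) * N \<le> \<sigma> * l"
    and "finite S" "F \<subseteq> Pow S" "G \<subseteq> Pow S"
    and "cross_avoiding F G {a..b}" "a \<le> b" "b \<le> int l" "int (card S) - int N \<le> a"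
  shows "card F * card G \<le> 4 ^ card S * exp (- potential \<kappa> \<sigma> \<gamma> l (card S) a b)"
  using assms(6-)
proof (induction S arbitrary: F G a b rule: finite_induct)
  case (empty F G a b)
  then have "card F * card G \<le> exp (- potential \<kappa> \<sigma> \<gamma> l 0 a b)"
    using potential_0_nonpos[OF rates]
    by (intro cross_avoiding_empty_ground_set[where L = "{a..b}"]) auto
  then show ?case by simp
next
  case (insert p S F G a b)
  have card_insert: "card (insert p S) = Suc (card S)" using insert by simp
  define X where "X = 4 ^ card S * exp (- potential \<kappa> \<sigma> \<gamma> l (Suc (card S)) a b)"
  have bound: "card A * card B \<le> X * exp t"
    if "A \<subseteq> Pow S" "B \<subseteq> Pow S" "cross_avoiding A B {a'..b'}" "a' \<le> b'" "b' \<le> b" "a - 1 \<le> a'"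
      and potential_eq: "potential \<kappa> \<sigma> \<gamma> l (Suc (card S)) a b = potential \<kappa> \<sigma> \<gamma> l (card S) a' b' + t"
    for A B a' b' t
  proof -
    have "card A * card B \<le> 4 ^ card S * exp (- potential \<kappa> \<sigma> \<gamma> l (card S) a' b')"
      using that insert.prems card_insert by (intro insert.IH) auto
    also have "\<dots> = X * exp t" unfolding X_def potential_eq by (simp flip: exp_add)
    finally show ?thesis .
  qed
  have "card F * card G \<le> 4 * X"
  proof (rule cross_avoiding_point_step[OF adm])
    fix A B assume AB: "A \<subseteq> Pow S" "B \<subseteq> Pow S"
    show "card A * card B \<le> X * exp \<kappa>" if "cross_avoiding A B {a..b}"
      using bound[OF AB that] insert.prems(4) by (simp add: potential_Suc(1))
    show "card A * card B \<le> X * exp \<sigma>" if "cross_avoiding A B {a - 1..b - 1}"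
      using bound[OF AB that] insert.prems(4) by (simp add: potential_Suc(2))
    show "card A * card B \<le> X * exp (- \<gamma>)" if "cross_avoiding A B {a - 1..b}"
      using bound[OF AB that] insert.prems(4) by (simp add: potential_Suc(3))
  qed (use insert.hyps insert.prems in \<open>auto simp: X_def\<close>)
  then show ?case by (simp add: card_insert X_def)
qed

theorem forbidden_cross_intersection:
  fixes l :: nat
  assumes S: "finite S" "4 * l \<le> card S" and FG: "F \<subseteq> Pow S" "G \<subseteq> Pow S"
    and avoid: "\<And>x y. x \<in> F \<Longrightarrow> y \<in> G \<Longrightarrow> card (x \<inter> y) \<noteq> l"
  shows "card F * card G \<le> 4 ^ card S * exp (- (real l)\<^sup>2 / (400 * card S))"
proof -
  define N where "N = card S"
  define r where "r = real l / N"
  define \<epsilon> where "\<epsilon> = r\<^sup>2 / 100"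
  have r: "0 \<le> r" "r \<le> 1 / 4" and r_mult_N: "r * N = l"
    using S(2) by (cases "N = 0"; auto simp: r_def field_simps simp flip: N_def)+
  have "r * r \<le> r * (1 / 4)" using r by (intro mult_left_mono) auto
  then have "admissible_factors (exp (2 * \<epsilon>)) (exp (r / 20)) (exp (- (3 * \<epsilon>)))"
    by (intro admissible_factors_exp) (auto simp: \<epsilon>_def power2_eq_square)
  moreover have "(2 * \<epsilon> + 3 * \<epsilon>) * N \<le> r / 20 * l"
    by (simp add: \<epsilon>_def power2_eq_square mult.assoc r_mult_N)
  moreover have "cross_avoiding F G {int l..int l}"
    using avoid by (auto simp: cross_avoiding_def)
  ultimately have
    "card F * card G \<le> 4 ^ N * exp (- potential (2 * \<epsilon>) (r / 20) (3 * \<epsilon>) l N (int l) (int l))"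
    unfolding N_def using S(1) FG r(1)
    by (intro cross_avoiding_potential_bound[where N = "card S"]) (auto simp: \<epsilon>_def)
  also have "\<dots> \<le> 4 ^ N * exp (- (real l)\<^sup>2 / (400 * N))"
  proof -
    have "(real l)\<^sup>2 / (400 * N) = \<epsilon> * (N / 4)"
      unfolding \<epsilon>_def r_mult_N[symmetric] by (simp add: power2_eq_square)
    also have "\<dots> \<le> \<epsilon> * (2 * real N - 7 * real l)"
      using S(2) by (intro mult_left_mono) (auto simp: \<epsilon>_def N_def)
    also have "\<dots> = potential (2 * \<epsilon>) (r / 20) (3 * \<epsilon>) l N (int l) (int l)"
      by (simp add: potential_def algebra_simps)
    finally show ?thesis by simp
  qed
  finally show ?thesis unfolding N_def .
qed

corollary forbidden_intersection:
  fixes l :: nat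
  assumes "finite S" "4 * l \<le> card S" "F \<subseteq> Pow S"
    and "\<And>x y. x \<in> F \<Longrightarrow> y \<in> F \<Longrightarrow> card (x \<inter> y) \<noteq> l"
  shows "card F \<le> 2 ^ card S * exp (- (real l)\<^sup>2 / (800 * card S))"
proof (rule power2_le_imp_le)
  have "(real (card F))\<^sup>2 \<le> 4 ^ card S * exp (- (real l)\<^sup>2 / (400 * card S))"
    using forbidden_cross_intersection[of S l F F] assms by (simp add: power2_eq_square)
  also have "\<dots> = (2 ^ card S * exp (- (real l)\<^sup>2 / (800 * card S)))\<^sup>2"
    using power_even_eq[of "2::real" "card S"]
    by (simp add: power_mult_distrib power_mult flip: exp_double)
  finally show "(real (card F))\<^sup>2 \<le> (2 ^ card S * exp (- (real l)\<^sup>2 / (800 * card S)))\<^sup>2" .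
qed simp

section \<open>Families meeting every set of a given size oddly\<close>

lemma card_sym_diff:
  assumes "finite x" "finite y"
  shows "card (sym_diff x y) + 2 * card (x \<inter> y) = card x + card y"
proof -
  have "card (sym_diff x y) = card (x - y) + card (y - x)"
    using assms by (intro card_Un_disjoint) auto
  then show ?thesis
    using assms card_Int_Diff[of x y] card_Int_Diff[of y x] by (simp add: Int_commute)
qed

lemma even_card_sym_diff_iff:
  assumes "finite x" "finite y"
  shows "even (card (sym_diff x y)) \<longleftrightarrow> (even (card x) \<longleftrightarrow> even (card y))"
  using card_sym_diff[OF assms] by presburger

lemma obtain_large_parity_class:
  assumes "finite T" "finite B"
  obtains C where "C \<subseteq> T" "card T \<le> 2 ^ card B * card C"
    "\<And>x y b. x \<in> C \<Longrightarrow> y \<in> C \<Longrightarrow> b \<in> B \<Longrightarrow> even (card (x \<inter> b)) \<longleftrightarrow> even (card (y \<inter> b))"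
proof -
  define parity where "parity x = {b \<in> B. even (card (x \<inter> b))}" for x
  obtain P where P: "card T \<le> card (parity -` {P} \<inter> T) * card (Pow B)"
    using pigeonhole_card[of parity T "Pow B"] assms by (auto simp: parity_def)
  show thesis
  proof (rule that)
    show "card T \<le> 2 ^ card B * card (parity -` {P} \<inter> T)"
      using P assms by (simp add: card_Pow mult.commute)
  qed (auto simp: parity_def)
qed

lemma odd_meeting_family_lower_bound:
  fixes S :: "'a set" and h l :: nat
  assumes S: "finite S" "card S = 2 * h" and h: "0 < h" "2 * l \<le> h" and B: "finite B"
    and odd_meet: "\<And>A. A \<subseteq> S \<Longrightarrow> card A + 2 * l = 2 * h \<Longrightarrow> \<exists>b\<in>B. odd (card (A \<inter> b))"
  shows "exp ((real l)\<^sup>2 / (1600 * h)) \<le> 2 * real h * 2 ^ card B"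
proof -
  define T where "T = {x. x \<subseteq> S \<and> card x = h}"
  have T: "finite T" "card T = (2 * h) choose h"
    using S n_subsets[OF S(1), of h] by (auto simp: T_def)
  obtain C where C: "C \<subseteq> T" "card T \<le> 2 ^ card B * card C"
    and parity: "\<And>x y b. x \<in> C \<Longrightarrow> y \<in> C \<Longrightarrow> b \<in> B \<Longrightarrow> even (card (x \<inter> b)) \<longleftrightarrow> even (card (y \<inter> b))"
    using obtain_large_parity_class[OF T(1) B] by blast
  have avoid: "card (x \<inter> y) \<noteq> l" if xy: "x \<in> C" "y \<in> C" for x y
  proof
    assume l: "card (x \<inter> y) = l"
    have sub: "x \<subseteq> S" "y \<subseteq> S" and card: "card x = h" "card y = h"
      using xy C(1) by (auto simp: T_def)
    have fin: "finite x" "finite y" using sub S(1) by (auto intro: finite_subset)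
    have "sym_diff x y \<subseteq> S" using sub by auto
    then obtain b where b: "b \<in> B" "odd (card (sym_diff x y \<inter> b))"
      using odd_meet[of "sym_diff x y"] card_sym_diff[OF fin] card l by auto
    have "sym_diff x y \<inter> b = sym_diff (x \<inter> b) (y \<inter> b)" by auto
    then show False
      using b parity[OF xy b(1)] even_card_sym_diff_iff[of "x \<inter> b" "y \<inter> b"] fin by simp
  qed
  have "C \<subseteq> Pow S" using C(1) by (auto simp: T_def)
  then have "card C \<le> 2 ^ card S * exp (- (real l)\<^sup>2 / (800 * card S))"
    using S h avoid by (intro forbidden_intersection) auto
  then have C_le: "card C \<le> 4 ^ h * exp (- ((real l)\<^sup>2 / (1600 * h)))"
    by (simp add: S(2) power_mult)
  have "4 ^ h / (2 * real h) \<le> card T"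
    using central_binomial_lower_bound[OF h(1)] T(2) by simp
  also have "\<dots> \<le> 2 ^ card B * real (card C)"
    using of_nat_mono[OF C(2), where 'a = real] by simp
  also have "\<dots> \<le> 2 ^ card B * (4 ^ h * exp (- ((real l)\<^sup>2 / (1600 * h))))"
    using C_le by (intro mult_left_mono) auto
  finally have "1 \<le> 2 * real h * 2 ^ card B * exp (- ((real l)\<^sup>2 / (1600 * h)))"
    using h(1) by (simp add: field_simps)
  then show ?thesis by (simp add: exp_minus field_simps)
qed

lemma linear_le_of_exp_le:
  fixes \<kappa> x :: real and m :: nat
  assumes \<kappa>: "0 < \<kappa>" "\<kappa> \<le> 1" and m: "1 \<le> m" and le: "exp (\<kappa> * x) \<le> 2 * x * 2 ^ m"
  shows "\<kappa>\<^sup>2 / 10 * x \<le> m"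
proof -
  have "0 < 2 * x * 2 ^ m" using le by (rule less_le_trans[OF exp_gt_zero])
  then have x: "0 < x" by (simp add: zero_less_mult_iff)
  have "2 * x = 4 / \<kappa> * (\<kappa> * x / 2)" using \<kappa> by simp
  also have "\<dots> \<le> exp (4 / \<kappa>) * exp (\<kappa> * x / 2)"
    using \<kappa> x exp_ge_add_one_self[of "4 / \<kappa>"] exp_ge_add_one_self[of "\<kappa> * x / 2"]
    by (intro mult_mono) (linarith | simp)+
  finally have two_x_le: "2 * x \<le> exp (4 / \<kappa>) * exp (\<kappa> * x / 2)" .
  have "(2::real) ^ m \<le> exp 1 ^ m" using exp_ge_add_one_self[of "1 :: real"] by (intro power_mono) auto
  then have "(2::real) ^ m \<le> exp (real m)" by (simp flip: exp_of_nat_mult)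
  with two_x_le have "2 * x * 2 ^ m \<le> exp (4 / \<kappa>) * exp (\<kappa> * x / 2) * exp (real m)"
    by (rule mult_mono) simp_all
  with le have "exp (\<kappa> * x) \<le> exp (4 / \<kappa> + \<kappa> * x / 2 + m)"
    by (simp add: exp_add)
  then have "\<kappa> * x / 2 \<le> 4 / \<kappa> + m" by simp
  then have "\<kappa>\<^sup>2 * x \<le> 8 + 2 * (\<kappa> * m)"
    using \<kappa> by (simp add: field_simps power2_eq_square)
  also have "\<dots> \<le> 8 + 2 * m" using \<kappa> by (simp add: mult_left_le_one_le)
  finally show ?thesis using m by simp
qed

section \<open>The secting number\<close>

lemma D_secting_odd_meet:
  assumes sect: "D_secting n {-1, 0, 1} F F'"
    and A: "A \<in> F" "A \<subseteq> {1..n}" "card A mod 4 = 2"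
  shows "\<exists>B\<in>F'. odd (card (A \<inter> B))"
proof -
  obtain B where B: "B \<in> F'"
    and discrepancy: "int (card (A \<inter> B)) - int (card (A \<inter> ({1..n} - B))) \<in> {-1, 0, 1}"
    using sect A(1) by (auto simp: D_secting_def)
  have "A \<inter> ({1..n} - B) = A - B" using A(2) by auto
  moreover have "card A = card (A \<inter> B) + card (A - B)"
    using A(2) by (intro card_Int_Diff) (auto intro: finite_subset)
  ultimately have "2 * card (A \<inter> B) = card A" using discrepancy A(3) by (auto; presburger)
  then have "odd (card (A \<inter> B))" using A(3) by presburger
  with B show ?thesis by blast
qed

lemma beta_le_beta_pm1:
  assumes "F \<subseteq> k_subsets n k"
  shows "beta n {-1, 0, 1} F \<le> beta_pm1 n k"
proof -
  have "finite (k_subsets n k)"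
    by (rule finite_subset[of _ "Pow {1..n}"]) (auto simp: k_subsets_def)
  moreover have "{beta n {-1, 0, 1} F | F. F \<subseteq> k_subsets n k} = beta n {-1, 0, 1} ` Pow (k_subsets n k)"
    by auto
  ultimately show ?thesis
    unfolding beta_pm1_def using assms by (intro Max_ge) auto
qed

lemma obtain_secting_family:
  obtains F' where "F' \<subseteq> Pow {1..n}" "D_secting n {-1, 0, 1} (k_subsets n k) F'"
    "card F' \<le> beta_pm1 n k"
proof -
  have "k_subsets n k \<subseteq> Pow {1..n}" by (auto simp: k_subsets_def)
  from beta_attained[OF this] show ?thesis
    using that beta_le_beta_pm1[of "k_subsets n k" n k] by (metis order_refl)
qed

lemma beta_pm1_pos:
  assumes "0 \<le> k" "k \<le> int n"
  shows "1 \<le> beta_pm1 n k"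
proof -
  obtain F' where F': "F' \<subseteq> Pow {1..n}" "D_secting n {-1, 0, 1} (k_subsets n k) F'"
    "card F' \<le> beta_pm1 n k" by (rule obtain_secting_family)
  have "{1..nat k} \<in> k_subsets n k" using assms by (auto simp: k_subsets_def)
  then have "F' \<noteq> {}" using F'(2) by (auto simp: D_secting_def)
  moreover have "finite F'" using F'(1) by (rule finite_subset) simp
  ultimately have "1 \<le> card F'" by (simp add: Suc_leI card_gt_0_iff)
  with F'(3) show ?thesis by simp
qed

lemma exp_le_beta_pm1:
  fixes n K h l :: nat
  assumes K: "K mod 4 = 2" and h: "0 < h" "2 * h \<le> n" and l: "2 * l \<le> h" "K + 2 * l = 2 * h"
  shows "exp ((real l)\<^sup>2 / (1600 * h)) \<le> 2 * real h * 2 ^ beta_pm1 n (int K)"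
proof -
  obtain F' where F': "F' \<subseteq> Pow {1..n}" "D_secting n {-1, 0, 1} (k_subsets n (int K)) F'"
    "card F' \<le> beta_pm1 n (int K)" by (rule obtain_secting_family)
  have "finite F'" using F'(1) by (rule finite_subset) simp
  moreover have "\<exists>B\<in>F'. odd (card (A \<inter> B))" if "A \<subseteq> {1..2 * h}" "card A + 2 * l = 2 * h" for A
  proof (rule D_secting_odd_meet[OF F'(2)])
    have "card A = K" using that(2) l(2) by simp
    moreover show "A \<subseteq> {1..n}" using that(1) h(2) by fastforce
    ultimately show "A \<in> k_subsets n (int K)" "card A mod 4 = 2" using K by (auto simp: k_subsets_def)
  qed
  ultimately have "exp ((real l)\<^sup>2 / (1600 * h)) \<le> 2 * real h * 2 ^ card F'"
    using h(1) l(1) by (intro odd_meeting_family_lower_bound[where S = "{1..2 * h}"]) auto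
  also have "\<dots> \<le> 2 * real h * 2 ^ beta_pm1 n (int K)"
    using F'(3) by (intro mult_left_mono power_increasing) auto
  finally show ?thesis .
qed

lemma obtain_half_ground_set:
  fixes c :: real and n K :: nat
  assumes c: "0 < c" "c < 1 / 2" "2 \<le> c * n"
    and K: "even K" "c * n \<le> 2 * K" "K < (1 - c) * n"
  obtains h l :: nat where "2 * h \<le> n" "K + 2 * l = 2 * h" "2 * l \<le> h"
    "c * n / 2 \<le> h" "c * h / 2 \<le> l"
proof -
  define h where "h = min K (n div 2)"
  define l where "l = h - K div 2"
  have "(1 - c) * n \<le> 1 * real n" using c by (intro mult_right_mono) auto
  then have "K < n" using K(3) by simp
  then have "K \<le> 2 * h" using K(1) by (auto simp: h_def)
  then have l: "K + 2 * l = 2 * h" using K(1) unfolding l_def by presburger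
  have half: "real n - 1 \<le> 2 * real (n div 2)" by linarith
  have cn: "c * n \<le> 1 / 2 * n" using c by (intro mult_right_mono) auto
  have h_ge: "c * n / 2 \<le> h"
    using K(2) half cn c(3) by (simp add: h_def min_def)
  have l_ge: "c * h / 2 \<le> l"
  proof (cases "K \<le> n div 2")
    case True
    then have "h = 2 * l" using l by (simp add: h_def)
    moreover have "c * real l \<le> 1 * real l" using c by (intro mult_right_mono) auto
    ultimately show ?thesis by simp
  next
    case False
    then have "real K + 2 * real l = 2 * real (n div 2)" using l by (simp add: h_def)
    then have "c * n / 4 \<le> l" using half K(3) c(3) by (simp add: algebra_simps)
    moreover have "c * (2 * h) \<le> c * n" using c by (intro mult_left_mono) (auto simp: h_def)
    ultimately show ?thesis by simp
  qed
  show thesis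
    by (rule that[of h l]) (use l h_ge l_ge in \<open>auto simp: h_def\<close>)
qed

text \<open>An intersection size \<open>l \<ge> c h / 2\<close> gives the exponential rate \<open>\<kappa> = c\<^sup>2 / 6400\<close> in \<open>h\<close>, which
  costs a factor \<open>\<kappa> / 10\<close> when it is traded for a linear bound; finally \<open>h \<ge> c n / 2\<close>.\<close>

definition linear_rate :: "real \<Rightarrow> real" where
  "linear_rate c = c * (c\<^sup>2 / 6400)\<^sup>2 / 20"

lemma beta_pm1_linear:
  fixes c :: real and n K :: nat
  assumes c: "0 < c" "c < 1 / 2" "2 \<le> c * n"
    and K: "K mod 4 = 2" "c * n \<le> 2 * K" "K < (1 - c) * n"
  shows "linear_rate c * n \<le> beta_pm1 n (int K)"
proof -
  define \<kappa> where "\<kappa> = c\<^sup>2 / 6400"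
  have "c\<^sup>2 \<le> 1" using c by (simp add: power_le_one)
  then have \<kappa>: "0 < \<kappa>" "\<kappa> \<le> 1" using c by (simp_all add: \<kappa>_def)
  have "even K" using K(1) by presburger
  then obtain h l where h: "2 * h \<le> n" and l: "K + 2 * l = 2 * h" "2 * l \<le> h"
    and h_ge: "c * n / 2 \<le> h" and l_ge: "c * h / 2 \<le> l"
    using obtain_half_ground_set[OF c _ K(2,3)] by blast
  have h_pos: "0 < h" using h_ge c(3) by (cases "h = 0") auto
  have "(c * h / 2)\<^sup>2 \<le> (real l)\<^sup>2" using l_ge c by (intro power_mono) auto
  then have "\<kappa> * h \<le> (real l)\<^sup>2 / (1600 * h)"
    using h_pos by (simp add: \<kappa>_def field_simps power2_eq_square)
  then have "exp (\<kappa> * h) \<le> exp ((real l)\<^sup>2 / (1600 * h))" by simp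
  also have "\<dots> \<le> 2 * real h * 2 ^ beta_pm1 n (int K)"
    by (rule exp_le_beta_pm1[OF K(1) h_pos h l(2,1)])
  finally have exp_le: "exp (\<kappa> * h) \<le> 2 * real h * 2 ^ beta_pm1 n (int K)" .
  have "K \<le> n" using h l by linarith
  then have "1 \<le> beta_pm1 n (int K)" by (intro beta_pm1_pos) auto
  then have "\<kappa>\<^sup>2 / 10 * h \<le> beta_pm1 n (int K)" using exp_le by (rule linear_le_of_exp_le[OF \<kappa>])
  moreover have "\<kappa>\<^sup>2 / 10 * (c * n / 2) \<le> \<kappa>\<^sup>2 / 10 * h" using h_ge by (intro mult_left_mono) auto
  ultimately show ?thesis by (simp add: linear_rate_def \<kappa>_def mult_ac)
qed

lemma exists_size_beta_pm1_linear:
  fixes c :: real and n :: nat and k :: int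
  assumes c: "0 < c" "c < 1 / 2" and k: "c * n < k" "k < (1 - c) * n"
  shows "\<exists>j\<in>{k, k - 1, k - 2, k - 3}. linear_rate c * n \<le> beta_pm1 n j"
proof (cases "c * n < 6")
  case True
  have "0 \<le> c * n" "c\<^sup>2 \<le> 1" using c by (simp_all add: power_le_one)
  then have "(c\<^sup>2 / 6400)\<^sup>2 \<le> 1" by (intro power_le_one) auto
  then have "c * n * (c\<^sup>2 / 6400)\<^sup>2 \<le> c * n * 1" using \<open>0 \<le> c * n\<close> by (rule mult_left_mono)
  then have "linear_rate c * n \<le> 1" using True by (simp add: linear_rate_def mult_ac)
  also have "1 \<le> real (beta_pm1 n k)"
  proof -
    have "(1 - c) * n = n - c * n" by (simp add: algebra_simps)
    then have "0 \<le> k" "k \<le> int n" using k \<open>0 \<le> c * n\<close> by linarith+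
    then show ?thesis using beta_pm1_pos by simp
  qed
  finally show ?thesis by blast
next
  case False
  have "2 \<le> k" using False k(1) by linarith
  define K where "K = 4 * nat ((k - 2) div 4) + 2"
  have K: "K mod 4 = 2" unfolding K_def by presburger
  have "int K = 4 * ((k - 2) div 4) + 2"
    using \<open>2 \<le> k\<close> by (simp add: K_def pos_imp_zdiv_nonneg_iff)
  then have K_range: "k - 3 \<le> int K" "int K \<le> k" by linarith+
  have "k - 3 \<le> real K" "real K \<le> k" using K_range by linarith+
  then have "c * n \<le> 2 * real K" "K < (1 - c) * n" using False k by linarith+
  then have "linear_rate c * n \<le> beta_pm1 n (int K)"
    using c K False by (intro beta_pm1_linear) auto
  moreover have "int K \<in> {k, k - 1, k - 2, k - 3}" using K_range by auto
  ultimately show ?thesis by blast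
qed

theorem theorem5:
  fixes c :: real
  assumes "0 < c" and "c < 1 / 2"
  shows "\<exists>\<delta>::real. \<delta> > 0 \<and>
           (\<forall>(n::nat) (k::int). c * real n < real_of_int k \<and> real_of_int k < (1 - c) * real n \<longrightarrow>
              real (Max {beta_pm1 n k, beta_pm1 n (k - 1), beta_pm1 n (k - 2), beta_pm1 n (k - 3)})
                \<ge> \<delta> * real n)"
proof (intro exI conjI allI impI)
  show "0 < linear_rate c" using assms(1) by (simp add: linear_rate_def)
next
  fix n :: nat and k :: int
  let ?sizes = "{k, k - 1, k - 2, k - 3}"
  assume "c * n < k \<and> k < (1 - c) * n"
  then obtain j where "j \<in> ?sizes" and linear: "linear_rate c * n \<le> beta_pm1 n j"
    using exists_size_beta_pm1_linear assms by blast
  then have "beta_pm1 n j \<le> Max (beta_pm1 n ` ?sizes)" by (intro Max_ge) auto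
  then show "linear_rate c * n
      \<le> Max {beta_pm1 n k, beta_pm1 n (k - 1), beta_pm1 n (k - 2), beta_pm1 n (k - 3)}"
    using linear by simp
qed

end
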